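(* Let $\mathcal{A}$ be a unital C*-algebra. Suppose there are isometries $u,v\in\mathcal{A}$ such that $u^*u=v^*v=uu^*+vv^*=1_{\mathcal{A}}$ and $u^*v=v^*u=0$. Then there is a constant $\gamma>0$, independent of $\varepsilon$, such that for each $0<\varepsilon\le 1/2$ there exist $d,x\in\mathcal{A}$ with $$\|[d,x]-1_{\mathcal{A}}\|\le\varepsilon$$ and $$\|d\|\,\|x\|\le\gamma\left(\log\frac{1}{\varepsilon}\right)^5 .$$
   Context: For elements $d,x$ of an algebra, $[d,x]:=dx-xd$. The element $1_{\mathcal{A}}$ is the unit of $\mathcal{A}$ and $\log$ is the natural logarithm. *)

theory Defs
  imports Complex_Main
begin

text \<open>
  A C*-algebra is a Banach algebra over the complex numbers with a conjugate-linear,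
  antimultiplicative involution satisfying the C*-identity. The normed algebra classes of the
  library are over the reals; the complex scalar multiplication is added on top of them, and
  \<open>scaleR_scaleC\<close> makes the real one its restriction.
\<close>

class scaleC =
  fixes scaleC :: "complex \<Rightarrow> 'a \<Rightarrow> 'a"  (infixr "*\<^sub>C" 75)

class complex_banach_algebra = real_normed_algebra + banach + scaleC +
  assumes scaleC_add_right: "a *\<^sub>C (x + y) = a *\<^sub>C x + a *\<^sub>C y"
    and scaleC_add_left: "(a + b) *\<^sub>C x = a *\<^sub>C x + b *\<^sub>C x"
    and scaleC_scaleC: "a *\<^sub>C b *\<^sub>C x = (a * b) *\<^sub>C x"
    and scaleR_scaleC: "r *\<^sub>R x = complex_of_real r *\<^sub>C x"
    and mult_scaleC_left: "(a *\<^sub>C x) * y = a *\<^sub>C (x * y)"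
    and mult_scaleC_right: "x * (a *\<^sub>C y) = a *\<^sub>C (x * y)"
    and norm_scaleC: "norm (a *\<^sub>C x) = cmod a * norm x"

class cstar_algebra = complex_banach_algebra +
  fixes star :: "'a \<Rightarrow> 'a"
  assumes star_star: "star (star x) = x"
    and star_add: "star (x + y) = star x + star y"
    and star_scaleC: "star (a *\<^sub>C x) = cnj a *\<^sub>C star x"
    and star_mult: "star (x * y) = star y * star x"
    and cstar_identity: "norm (star x * x) = (norm x)\<^sup>2"

text \<open>
  The unit is added through \<open>monoid_mult\<close> rather than \<open>ring_1\<close> or
  \<open>real_normed_algebra_1\<close>, which would exclude the zero algebra. In a nonzero algebra
  \<open>norm 1 = 1\<close> follows from the C*-identity.
\<close>

class unital_cstar_algebra = cstar_algebra + monoid_mult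

definition commutator :: "'a::ring \<Rightarrow> 'a \<Rightarrow> 'a"
  where "commutator d x = d * x - x * d"

end

theory Submission
  imports Defs "HOL-Real_Asymp.Real_Asymp"
begin

text \<open>
  The construction is Tao's. In the algebra of \<open>n \<times> n\<close> matrices, which the Cuntz relations embed
  unitally into the algebra itself, differentiation and multiplication by the variable on
  polynomials of degree less than \<open>n\<close> have a commutator which differs from \<open>1\<close> only in the last
  diagonal entry. Replacing the multiplication \<open>X\<close> by a companion matrix with last column \<open>b\<close> and
  adding \<open>\<mu> (v + X u)\<close> to the differentiation moves the error into the last column, where its
  \<open>i\<close>-th entry is
  \<open>\<mu> ([v, b\<^sub>i] + [u, b\<^sub>i\<^sub>-\<^sub>1] + b\<^sub>i [u, b\<^sub>n]) + i b\<^sub>i\<^sub>+\<^sub>1\<close>, minus \<open>n\<close> for \<open>i = n\<close>. The linear map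
  \<open>b \<mapsto> [v, b\<^sub>i] + [u, b\<^sub>i\<^sub>-\<^sub>1]\<close> has a right inverse of norm \<open>O(n\<^sup>2)\<close>, so with \<open>\<mu>\<close> of order \<open>n\<^sup>5\<close>
  the entries with \<open>i \<ge> 2\<close> can be made arbitrarily small by iterating a contraction. The remaining
  entry, in the corner, is damped by the factor \<open>2\<^sup>1\<^sup>-\<^sup>n\<close> on conjugating with a diagonal matrix, and
  \<open>n\<close> is taken proportional to \<open>log (1/\<epsilon>)\<close>.
\<close>

section \<open>Commutators of matrices of companion type\<close>

text \<open>\<open>t'\<close> need not be the adjoint of \<open>t\<close>, so that the algebra also
  covers matrix units conjugated by a diagonal matrix. The element \<open>t i * a * t' j\<close>
  stands for the matrix whose single entry \<open>a\<close> sits at \<open>(i, j)\<close>.\<close>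

locale dual_system =
  fixes n :: nat and t t' :: "nat \<Rightarrow> 'a::{real_algebra,monoid_mult}"
  assumes dual: "i \<in> {1..n} \<Longrightarrow> j \<in> {1..n} \<Longrightarrow> t' i * t j = (if i = j then 1 else 0)"
    and resolution: "(\<Sum>i=1..n. t i * t' i) = 1"
begin

definition ampliation :: "'a \<Rightarrow> 'a"
  where "ampliation a = (\<Sum>i=1..n. t i * a * t' i)"

text \<open>With \<open>t j\<close> read as the monomial of degree \<open>j - 1\<close>, this and
  the next element are truncated multiplication by the variable and differentiation.\<close>

definition lower_shift :: 'a
  where "lower_shift = (\<Sum>i=1..<n. t (Suc i) * t' i)"

definition weighted_upper_shift :: 'a
  where "weighted_upper_shift = (\<Sum>i=1..<n. real i *\<^sub>R (t i * t' (Suc i)))"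

definition last_column :: "(nat \<Rightarrow> 'a) \<Rightarrow> 'a"
  where "last_column b = (\<Sum>i=1..n. t i * b i * t' n)"

definition companion :: "(nat \<Rightarrow> 'a) \<Rightarrow> 'a"
  where "companion b = lower_shift + last_column b"

definition conjugate_variable :: "real \<Rightarrow> 'a \<Rightarrow> 'a \<Rightarrow> (nat \<Rightarrow> 'a) \<Rightarrow> 'a"
  where "conjugate_variable \<mu> u v b =
    \<mu> *\<^sub>R (ampliation v + companion b * ampliation u) + weighted_upper_shift"

text \<open>By \<open>resolution\<close> an element is the sum of its columns \<open>A * t j\<close>
  times \<open>t' j\<close>, so matrix identities can be checked column by column.\<close>

lemma eqI:
  assumes "\<And>j. j \<in> {1..n} \<Longrightarrow> A * t j = B * t j"
  shows "A = B"
proof -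
  have "A = (\<Sum>j=1..n. A * t j * t' j)" for A :: 'a
    using arg_cong[OF resolution, of "\<lambda>x. A * x"] by (simp add: sum_distrib_left mult.assoc)
  from this[of A] this[of B] show ?thesis
    using assms by (metis (no_types, lifting) sum.cong)
qed

lemma ampliation_t: "j \<in> {1..n} \<Longrightarrow> ampliation a * t j = t j * a"
proof -
  assume j: "j \<in> {1..n}"
  have "ampliation a * t j = (\<Sum>i=1..n. if i = j then t j * a else 0)"
    unfolding ampliation_def sum_distrib_right
    using j by (intro sum.cong) (auto simp: mult.assoc dual)
  then show ?thesis using j by simp
qed

lemma lower_shift_t:
  assumes j: "j \<in> {1..n}"
  shows "lower_shift * t j = (if j < n then t (Suc j) else 0)"
proof -
  have "lower_shift * t j = (\<Sum>i=1..<n. if i = j then t (Suc j) else 0)"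
    unfolding lower_shift_def sum_distrib_right
    using j by (intro sum.cong) (auto simp: mult.assoc dual)
  then show ?thesis using j by simp
qed

lemma weighted_upper_shift_t:
  assumes j: "j \<in> {1..n}"
  shows "weighted_upper_shift * t j = real (j - 1) *\<^sub>R t (j - 1)"
proof -
  have "weighted_upper_shift * t j
      = (\<Sum>i=1..<n. if i = j - 1 then real (j - 1) *\<^sub>R t (j - 1) else 0)"
    unfolding weighted_upper_shift_def sum_distrib_right
    using j by (intro sum.cong) (auto simp: mult.assoc dual)
  then show ?thesis using j by auto
qed

lemma last_column_t:
  assumes j: "j \<in> {1..n}"
  shows "last_column b * t j = (if j = n then \<Sum>i=1..n. t i * b i else 0)"
proof -
  have "last_column b * t j = (\<Sum>i=1..n. if j = n then t i * b i else 0)"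
    unfolding last_column_def sum_distrib_right
    using j by (intro sum.cong) (auto simp: mult.assoc dual)
  then show ?thesis by simp
qed

lemma companion_t:
  assumes "j \<in> {1..n}"
  shows "companion b * t j = (if j < n then t (Suc j) else \<Sum>i=1..n. t i * b i)"
  using assms by (simp add: companion_def distrib_right lower_shift_t last_column_t)

text \<open>A companion matrix shifts the coordinates and feeds the last one into \<open>b\<close>.
  The value \<open>c 0 = 0\<close> makes the shift formula valid at \<open>i = 1\<close>
  too.\<close>

lemma companion_mult_vector:
  assumes c: "c 0 = 0"
  shows "companion b * (\<Sum>i=1..n. t i * c i) = (\<Sum>i=1..n. t i * (c (i - 1) + b i * c n))"
proof (cases n)
  case (Suc m)
  have "companion b * (\<Sum>i=1..n. t i * c i)
      = (\<Sum>i=1..n. (companion b * t i) * c i)"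
    by (simp add: sum_distrib_left mult.assoc)
  also have "\<dots> = (\<Sum>i=1..m. (companion b * t i) * c i) + (companion b * t n) * c n"
    using Suc by simp
  also have "(\<Sum>i=1..m. (companion b * t i) * c i) = (\<Sum>i=1..m. t (Suc i) * c i)"
    by (intro sum.cong refl, subst companion_t) (use Suc in auto)
  also have "\<dots> = (\<Sum>i=Suc 1..Suc m. t i * c (i - 1))"
    unfolding sum.shift_bounds_cl_Suc_ivl by simp
  also have "\<dots> = (\<Sum>i=1..n. t i * c (i - 1))"
    unfolding Suc by (subst sum.atLeast_Suc_atMost[of 1 "Suc m"]) (auto simp: c)
  also have "(companion b * t n) * c n = (\<Sum>i=1..n. t i * (b i * c n))"
    by (subst companion_t) (use Suc in \<open>auto simp: distrib_right sum_distrib_right mult.assoc\<close>)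
  finally show ?thesis
    by (simp add: distrib_left sum.distrib)
qed simp

lemma weighted_upper_shift_mult_vector:
  assumes c: "c (Suc n) = 0"
  shows "weighted_upper_shift * (\<Sum>i=1..n. t i * c i)
    = (\<Sum>i=1..n. t i * (real i *\<^sub>R c (Suc i)))"
proof (cases n)
  case (Suc m)
  have "weighted_upper_shift * (\<Sum>i=1..n. t i * c i)
      = (\<Sum>i=1..n. (weighted_upper_shift * t i) * c i)"
    by (simp add: sum_distrib_left mult.assoc)
  also have "\<dots> = (\<Sum>i=1..Suc m. t (i - 1) * (real (i - 1) *\<^sub>R c i))"
    by (rule sum.cong, use Suc in simp, subst weighted_upper_shift_t) (use Suc in auto)
  also have "\<dots> = (\<Sum>i=Suc 1..Suc m. t (i - 1) * (real (i - 1) *\<^sub>R c i))"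
    by (subst sum.atLeast_Suc_atMost[of 1 "Suc m"]) auto
  also have "\<dots> = (\<Sum>i=1..m. t i * (real i *\<^sub>R c (Suc i)))"
    unfolding sum.shift_bounds_cl_Suc_ivl by simp
  also have "\<dots> = (\<Sum>i=1..n. t i * (real i *\<^sub>R c (Suc i)))"
    using Suc c by simp
  finally show ?thesis .
qed simp

definition last_column_defect :: "real \<Rightarrow> 'a \<Rightarrow> 'a \<Rightarrow> (nat \<Rightarrow> 'a) \<Rightarrow> nat \<Rightarrow> 'a"
  where "last_column_defect \<mu> u v b i =
    \<mu> *\<^sub>R (commutator v (b i) + commutator u (b (i - 1)) + b i * commutator u (b n))
    + real i *\<^sub>R b (Suc i) - (if i = n then real n *\<^sub>R 1 else 0)"

text \<open>Before the last column \<open>companion b\<close> acts as the shift, so the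
  \<open>\<mu>\<close>-terms cancel and the weights differ by \<open>j - (j - 1) = 1\<close>. The
  last column is read off from the two vector lemmas; the zeros of \<open>b\<close> at
  \<open>0\<close> and \<open>Suc n\<close> remove the boundary cases.\<close>

lemma commutator_companion:
  assumes b: "b 0 = 0" "b (Suc n) = 0"
  shows "commutator (conjugate_variable \<mu> u v b) (companion b) - 1
    = last_column (last_column_defect \<mu> u v b)"
proof (rule eqI)
  define X where "X = companion b"
  define D where "D = conjugate_variable \<mu> u v b"
  fix j assume j: "j \<in> {1..n}"
  have D: "D * t i = \<mu> *\<^sub>R (t i * v + X * t i * u) + real (i - 1) *\<^sub>R t (i - 1)"
    if "i \<in> {1..n}" for i
    using that by (simp add: D_def X_def conjugate_variable_def distrib_right mult.assoc ampliation_t weighted_upper_shift_t)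
  have "(commutator D X - 1) * t j = last_column (last_column_defect \<mu> u v b) * t j"
  proof (cases "j < n")
    case True
    have "D * X * t j = D * t (Suc j)"
      using j True by (simp add: mult.assoc X_def companion_t)
    also have "\<dots> = \<mu> *\<^sub>R (t (Suc j) * v + X * t (Suc j) * u) + real j *\<^sub>R t j"
      using j True by (simp add: D)
    finally have DX: "D * X * t j = \<dots>" .
    have "X * D * t j = \<mu> *\<^sub>R (X * t j * v + X * (X * t j) * u) + real (j - 1) *\<^sub>R (X * t (j - 1))"
      using j by (simp add: mult.assoc D distrib_left)
    also have "X * t j = t (Suc j)"
      using j True by (simp add: X_def companion_t)
    \<comment> \<open>\<open>t 0\<close> is unspecified, but at \<open>j = 1\<close> its coefficient
      vanishes.\<close>
    also have "real (j - 1) *\<^sub>R (X * t (j - 1)) = real (j - 1) *\<^sub>R t j"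
    proof (cases "j = 1")
      case False
      then have "j - 1 \<in> {1..n}" "j - 1 < n" "Suc (j - 1) = j"
        using j by auto
      then show ?thesis
        by (simp only: X_def companion_t) simp
    qed simp
    finally have "X * D * t j
      = \<mu> *\<^sub>R (t (Suc j) * v + X * t (Suc j) * u) + real (j - 1) *\<^sub>R t j" .
    moreover have "real j *\<^sub>R t j = real (j - 1) *\<^sub>R t j + t j"
      using j by (simp add: of_nat_diff algebra_simps)
    ultimately show ?thesis
      using True j DX by (simp add: commutator_def left_diff_distrib last_column_t)
  next
    case False
    then have [simp]: "j = n" and n: "n \<in> {1..n}" using j by auto
    have Xn: "X * t n = (\<Sum>i=1..n. t i * b i)"
      using n by (simp add: X_def companion_t)
    have "D * X * t n = (\<Sum>i=1..n. D * t i * b i)"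
      by (simp add: mult.assoc Xn sum_distrib_left)
    also have "\<dots> = (\<Sum>i=1..n. \<mu> *\<^sub>R (t i * (v * b i)) + \<mu> *\<^sub>R (X * (t i * (u * b i)))
        + weighted_upper_shift * (t i * b i))"
      by (intro sum.cong) (auto simp: D distrib_right scaleR_right_distrib mult.assoc
          weighted_upper_shift_t simp flip: mult.assoc[of weighted_upper_shift])
    also have "\<dots> = \<mu> *\<^sub>R (\<Sum>i=1..n. t i * (v * b i)) + \<mu> *\<^sub>R (X * (\<Sum>i=1..n. t i * (u * b i)))
        + weighted_upper_shift * (\<Sum>i=1..n. t i * b i)"
      by (simp add: sum.distrib scaleR_sum_right sum_distrib_left)
    finally have DX: "D * X * t n = \<dots>" .
    have Xn': "X * t (n - 1) = t n" if "n > 1"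
      using that by (simp add: X_def companion_t)
    have "X * D * t n = \<mu> *\<^sub>R (X * t n * v + X * (X * t n * u)) + real (n - 1) *\<^sub>R (X * t (n - 1))"
      using n by (simp add: mult.assoc D distrib_left)
    also have "real (n - 1) *\<^sub>R (X * t (n - 1)) = (real n - 1) *\<^sub>R t n"
      using n Xn' by (cases "n = 1") (auto simp: of_nat_diff)
    finally have XD: "X * D * t n = \<mu> *\<^sub>R (\<Sum>i=1..n. t i * (b i * v))
        + \<mu> *\<^sub>R (X * (\<Sum>i=1..n. t i * (b i * u))) + (real n - 1) *\<^sub>R t n"
      by (simp add: Xn sum_distrib_right mult.assoc scaleR_right_distrib)
    have *: "commutator u (b 0) = 0"
      by (simp add: commutator_def b)
    \<comment> \<open>The coefficient \<open>n - 1\<close> from differentiation and the subtracted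
      unit together give \<open>n\<close>, with its only coordinate at \<open>i = n\<close>.\<close>
    have tn: "real n *\<^sub>R t n = (\<Sum>i=1..n. t i * (if i = n then real n *\<^sub>R 1 else 0))"
      using n by (simp add: if_distrib cong: if_cong)
    have "(commutator D X - 1) * t n
        = \<mu> *\<^sub>R (\<Sum>i=1..n. t i * commutator v (b i))
          + \<mu> *\<^sub>R (X * (\<Sum>i=1..n. t i * commutator u (b i)))
          + weighted_upper_shift * (\<Sum>i=1..n. t i * b i) - real n *\<^sub>R t n"
      unfolding commutator_def left_diff_distrib DX XD right_diff_distrib sum_subtractf
        scaleR_right_diff_distrib
      by (simp add: algebra_simps)
    also have "\<dots> = (\<Sum>i=1..n. t i * last_column_defect \<mu> u v b i)"
      unfolding X_def tn weighted_upper_shift_mult_vector[of b, OF b(2)]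
        companion_mult_vector[of "\<lambda>i. commutator u (b i)", OF *]
      by (simp add: last_column_defect_def scaleR_sum_right distrib_left right_diff_distrib
          sum.distrib sum_subtractf scaleR_right_distrib)
    finally show ?thesis
      using n by (simp add: last_column_t)
  qed
  then show "(commutator (conjugate_variable \<mu> u v b) (companion b) - 1) * t j
      = last_column (last_column_defect \<mu> u v b) * t j"
    by (simp only: X_def D_def)
qed

end

section \<open>Norms in C*-algebras\<close>

lemma star_0 [simp]: "star (0::'a::cstar_algebra) = 0"
  using star_add[of "0::'a" 0] by simp

lemma star_sum: "star (\<Sum>i\<in>A. f i) = (\<Sum>i\<in>A. star (f i :: 'a::cstar_algebra))"
  by (induction A rule: infinite_finite_induct) (auto simp: star_add)

lemma star_1 [simp]: "star (1::'a::unital_cstar_algebra) = 1"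
  using star_mult[of "star 1" "1::'a"] by (simp add: star_star)

lemma norm_le_norm_star: "norm x \<le> norm (star x :: 'a::cstar_algebra)"
proof (cases "x = 0")
  case False
  have "(norm x)\<^sup>2 \<le> norm (star x) * norm x"
    using norm_mult_ineq[of "star x" x] by (simp add: cstar_identity)
  then show ?thesis using False by (simp add: power2_eq_square)
qed simp

lemma norm_star [simp]: "norm (star x) = norm (x::'a::cstar_algebra)"
  using norm_le_norm_star[of x] norm_le_norm_star[of "star x"] by (simp add: star_star)

text \<open>The hypothesis makes \<open>star a * a\<close> a projection, whose norm equals its own
  square by the C*-identity. The truncated shift needs this form, not being an isometry.\<close>

lemma norm_partial_isometry:
  fixes a :: "'a::cstar_algebra"
  assumes "a * (star a * a) = a"
  shows "norm a \<le> 1"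
proof -
  let ?p = "star a * a"
  have "star ?p * ?p = ?p"
    using assms by (simp add: star_mult star_star mult.assoc)
  then have "norm ?p = (norm ?p)\<^sup>2"
    using cstar_identity[of ?p] by simp
  then have "norm ?p \<le> 1"
    by (cases "norm ?p = 0") (auto simp: power2_eq_square simp del: norm_eq_zero)
  then have "(norm a)\<^sup>2 \<le> 1\<^sup>2"
    by (simp add: cstar_identity)
  then show ?thesis
    by (rule power2_le_imp_le) simp
qed

lemma norm_isometry: "star a * a = 1 \<Longrightarrow> norm (a::'a::unital_cstar_algebra) \<le> 1"
  by (rule norm_partial_isometry) simp

lemma norm_commutator:
  fixes a b :: "'a::real_normed_algebra"
  assumes ab: "norm a \<le> 1" "norm b \<le> d"
  shows "norm (commutator a b) \<le> 2 * d"
proof -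
  have "norm (a * b) \<le> 1 * d" "norm (b * a) \<le> d * 1"
    using ab norm_ge_zero[of a] norm_ge_zero[of b]
    by (intro order_trans[OF norm_mult_ineq] mult_mono; linarith)+
  then show ?thesis
    unfolding commutator_def using norm_triangle_ineq4[of "a * b" "b * a"] by linarith
qed

lemma half_two_power: "(1/2) ^ i * 2 ^ i = (1::real)" "2 ^ i * (1/2) ^ i = (1::real)"
  by (simp_all add: power_one_over)

section \<open>The matrix units of a Cuntz pair\<close>

locale cuntz_pair =
  fixes u v :: "'a::unital_cstar_algebra"
  assumes uu: "star u * u = 1"
    and vv: "star v * v = 1"
    and range_sum: "u * star u + v * star v = 1"
    and uv: "star u * v = 0"
    and vu: "star v * u = 0"
begin

lemma cancel [simp]:
  "star u * (u * x) = x" "star v * (v * x) = x" "star u * (v * x) = 0" "star v * (u * x) = 0"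
  by (simp_all flip: mult.assoc add: uu vv uv vu)

text \<open>The Cuntz relations kill the cross terms in the C*-identity. This Pythagorean bound,
  unlike the triangle inequality, is sharp enough for a contraction later.\<close>

lemma norm_row: "(norm (v * x + u * y))\<^sup>2 \<le> (norm x)\<^sup>2 + (norm y)\<^sup>2"
proof -
  have "star (v * x + u * y) * (v * x + u * y) = star x * x + star y * y"
    by (simp add: star_add star_mult distrib_left distrib_right mult.assoc)
  then have "(norm (v * x + u * y))\<^sup>2 = norm (star x * x + star y * y)"
    by (metis cstar_identity)
  also have "\<dots> \<le> norm (star x * x) + norm (star y * y)"
    by (rule norm_triangle_ineq)
  finally show ?thesis by (simp add: cstar_identity)
qed

lemma norm_column: "(norm (x * star v + y * star u))\<^sup>2 \<le> (norm x)\<^sup>2 + (norm y)\<^sup>2"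
  using norm_row[of "star x" "star y"] norm_star[of "x * star v + y * star u"]
  by (simp add: star_add star_mult star_star)

lemma star_power: "star (v ^ k) = star v ^ k"
  by (induction k) (simp_all add: star_mult power_commutes)

lemma star_power_mult [simp]: "star v ^ k * (v ^ k * x) = x"
proof (induction k arbitrary: x)
  case (Suc k)
  have "star v ^ Suc k * (v ^ Suc k * x) = star v ^ k * (star v * (v * (v ^ k * x)))"
    by (simp only: power_Suc2[of "star v"] power_Suc[of v] mult.assoc)
  then show ?case by (simp only: Suc cancel)
qed simp

text \<open>The words \<open>u\<close>, \<open>v u\<close>, ..., \<open>v^(n-2) u\<close>,
  \<open>v^(n-1)\<close> form a complete prefix code: the last one has no \<open>u\<close> because
  it takes the whole remaining range.\<close>

definition isometries :: "nat \<Rightarrow> nat \<Rightarrow> 'a"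
  where "isometries n i = (if i < n then v ^ (i - 1) * u else v ^ (n - 1))"

lemma star_isometries_mult_less:
  assumes "i \<in> {1..n}" "j \<in> {1..n}" "i < j"
  shows "star (isometries n i) * isometries n j = 0"
proof -
  \<comment> \<open>After \<open>v ^ (i - 1)\<close> is cancelled at least one \<open>v\<close>
    remains and meets \<open>star u\<close>.\<close>
  have "j - 1 = (i - 1) + Suc (j - i - 1)"
    using assms by auto
  then have *: "star u * (star v ^ (i - 1) * (v ^ (j - 1) * x)) = 0" for x
    by (simp only: power_add power_Suc mult.assoc star_power_mult cancel)
  have "isometries n j = v ^ (j - 1) * (if j < n then u else 1)"
    using assms by (auto simp: isometries_def)
  then show ?thesis
    using assms * by (simp add: isometries_def star_mult star_power mult.assoc)
qed

lemma star_isometries_mult: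
  assumes ij: "i \<in> {1..n}" "j \<in> {1..n}"
  shows "star (isometries n i) * isometries n j = (if i = j then 1 else 0)"
proof (cases i j rule: linorder_cases)
  case greater
  have "star (star (isometries n j) * isometries n i) = 0"
    using star_isometries_mult_less[OF ij(2,1) greater] by simp
  then show ?thesis using greater by (simp add: star_mult star_star)
next
  case equal
  have "star v ^ k * v ^ k = 1" for k
    using star_power_mult[of k 1] by simp
  then show ?thesis
    using equal uu by (simp add: isometries_def star_mult star_power mult.assoc)
qed (use star_isometries_mult_less[OF ij] in simp)

lemma sum_isometries_star:
  assumes "1 \<le> n"
  shows "(\<Sum>i=1..n. isometries n i * star (isometries n i)) = 1"
proof -
  \<comment> \<open>Telescoping: \<open>range_sum\<close> between \<open>v ^ m\<close> and its
    adjoint splits the projection \<open>v ^ m * star v ^ m\<close> into the next summand and the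
    next remainder.\<close>
  have *: "(\<Sum>i=1..m. v ^ (i - 1) * u * star (v ^ (i - 1) * u)) = 1 - v ^ m * star v ^ m" for m
  proof (induction m)
    case (Suc m)
    have "v ^ m * u * star (v ^ m * u) + v ^ Suc m * star v ^ Suc m
        = v ^ m * (u * star u + v * star v) * star v ^ m"
      by (simp only: star_mult star_power power_Suc2[of v] power_Suc[of "star v"]
          distrib_left distrib_right mult.assoc)
    then have "v ^ m * u * star (v ^ m * u) = v ^ m * star v ^ m - v ^ Suc m * star v ^ Suc m"
      by (simp only: range_sum mult_1_right eq_diff_eq)
    with Suc show ?case
      by (simp del: power_Suc)
  qed simp
  obtain m where [simp]: "n = Suc m" using assms by (cases n) auto
  have "(\<Sum>i=1..m. isometries n i * star (isometries n i))
      = (\<Sum>i=1..m. v ^ (i - 1) * u * star (v ^ (i - 1) * u))"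
    by (intro sum.cong) (auto simp: isometries_def)
  then have "(\<Sum>i=1..m. isometries n i * star (isometries n i)) = 1 - v ^ m * star v ^ m"
    by (simp only: *)
  then show ?thesis
    by (simp add: isometries_def star_power)
qed


lemma norm_isometries: "i \<in> {1..n} \<Longrightarrow> norm (isometries n i) \<le> 1"
  by (rule norm_isometry) (simp add: star_isometries_mult)

text \<open>Conjugating the matrix units by the diagonal matrix with entries \<open>2 ^ i\<close> leaves the algebra
  unchanged and damps the entry at \<open>(i, n)\<close> by the factor \<open>2 ^ (n - i)\<close>.\<close>

lemma dual_system_isometries:
  assumes "1 \<le> n"
  shows "dual_system n (\<lambda>i. 2 ^ i *\<^sub>R isometries n i) (\<lambda>i. (1/2) ^ i *\<^sub>R star (isometries n i))"
proof
  fix i j assume ij: "i \<in> {1..n}" "j \<in> {1..n}"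
  show "(1/2) ^ i *\<^sub>R star (isometries n i) * 2 ^ j *\<^sub>R isometries n j = (if i = j then 1 else 0)"
    unfolding mult_scaleR_left mult_scaleR_right scaleR_scaleR star_isometries_mult[OF ij]
    by (cases "i = j") (simp_all only: half_two_power scaleR_one scaleR_zero_right if_True if_False)
next
  show "(\<Sum>i=1..n. 2 ^ i *\<^sub>R isometries n i * (1/2) ^ i *\<^sub>R star (isometries n i)) = 1"
    unfolding mult_scaleR_left mult_scaleR_right scaleR_scaleR half_two_power scaleR_one
    by (rule sum_isometries_star[OF assms])
qed

end

section \<open>Approximate solution of the last column equations\<close>

text \<open>Each iteration shrinks the residual by \<open>q\<close>, starting from at most
  \<open>2 * r\<close>. An approximate solution suffices, so the iteration stops and no limit is
  formed. The sup norm is expressed by bounds uniform in the index.\<close>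

lemma approximate_fixed_point:
  fixes F :: "('i \<Rightarrow> 'a::real_normed_vector) \<Rightarrow> 'i \<Rightarrow> 'a"
  assumes "z0 \<in> B" and FB: "\<And>z. z \<in> B \<Longrightarrow> F z \<in> B"
    and bound: "\<And>z i. z \<in> B \<Longrightarrow> norm (z i) \<le> r"
    and lipschitz: "\<And>z w d i. z \<in> B \<Longrightarrow> w \<in> B \<Longrightarrow> (\<And>j. norm (z j - w j) \<le> d) \<Longrightarrow>
      norm (F z i - F w i) \<le> q * d"
    and q: "0 \<le> q" "q < 1" and "0 < \<delta>"
  obtains z where "z \<in> B" "\<And>i. norm (F z i - z i) \<le> \<delta>"
proof -
  define z where "z k = (F ^^ k) z0" for k
  have zB: "z k \<in> B" for k
    by (induction k) (auto simp: z_def assms(1) FB)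
  have step: "norm (F (z k) i - z k i) \<le> q ^ k * (2 * r)" for k i
  proof (induction k arbitrary: i)
    case 0
    show ?case
      using norm_triangle_ineq4[of "F (z 0) i" "z 0 i"] bound[OF zB[of 0], of i]
        bound[OF FB[OF zB[of 0]], of i] by simp
  next
    case (Suc k)
    have "z (Suc k) = F (z k)" by (simp add: z_def)
    then show ?case
      using lipschitz[OF FB[OF zB[of k]] zB[of k] Suc] by (simp add: mult.assoc)
  qed
  have "(\<lambda>k. q ^ k * (2 * r)) \<longlonglongrightarrow> 0"
    using tendsto_mult_left_zero[OF LIMSEQ_realpow_zero[OF q]] .
  then have "\<forall>\<^sub>F k in sequentially. q ^ k * (2 * r) < \<delta>"
    using \<open>0 < \<delta>\<close> by (rule order_tendstoD(2))
  then obtain k where k: "q ^ k * (2 * r) < \<delta>"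
    using eventually_happens'[OF sequentially_bot] by blast
  show ?thesis
  proof (rule that[OF zB[of k]])
    fix i show "norm (F (z k) i - z k i) \<le> \<delta>"
      using step[of k i] k by linarith
  qed
qed

text \<open>With constant weights \<open>1/2\<close> the linear part of the fixed point map below would
  only be nonexpansive; the slow increase of the weights makes it a contraction.\<close>

locale companion_equations = cuntz_pair +
  fixes n :: nat
  assumes n: "2 \<le> n"
begin

section \<open>Parameters and weights\<close>

definition h :: real
  where "h = 1 / (8 * real n ^ 2)"

definition \<alpha> :: "nat \<Rightarrow> real"
  where "\<alpha> i = 1/2 + real i * h"

text \<open>Chosen so that \<open>real n / \<mu>\<close> is \<open>h\<^sup>2 / 128\<close>, small
  against the contraction margin on a ball of radius \<open>h / 16\<close>. As \<open>h\<close> is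
  of order \<open>n^-2\<close>, this costs \<open>n^5\<close>, the source of the fifth power of the
  logarithm.\<close>

definition \<mu> :: real
  where "\<mu> = 8192 * real n ^ 5"

lemma h: "0 < h" "h \<le> 1/32" "8 * real n ^ 2 * h = 1"
proof -
  have *: "4 \<le> x \<Longrightarrow> 0 < 1 / (8 * x) \<and> 1 / (8 * x) \<le> 1/32 \<and> 8 * x * (1 / (8 * x)) = 1" for x :: real
    by (auto simp: field_simps)
  have "4 \<le> real n ^ 2"
    using power_mono[of 2 "real n" 2] n by simp
  from *[OF this] show "0 < h" "h \<le> 1/32" "8 * real n ^ 2 * h = 1"
    unfolding h_def by blast+
qed

lemma \<mu>: "1 \<le> \<mu>" "real n / \<mu> = h\<^sup>2 / 128"
proof -
  show "real n / \<mu> = h\<^sup>2 / 128"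
  proof -
    have *: "0 < x \<Longrightarrow> x / (8192 * x ^ 5) = (1 / (8 * x ^ 2))\<^sup>2 / 128" for x :: real
      by (simp add: power_divide power_mult_distrib) (simp add: power_def field_simps)
    show ?thesis unfolding \<mu>_def h_def using n by (intro *) simp
  qed
  have "1 * 1 \<le> 8192 * real n ^ 5"
    using n by (intro mult_mono one_le_power) auto
  then show "1 \<le> \<mu>"
    by (simp only: \<mu>_def mult_1)
qed

text \<open>The range reaches \<open>n + 2\<close> because \<open>column_of z (n + 1)\<close>
  involves that weight.\<close>

lemma weights_bounds: "i \<le> n + 2 \<Longrightarrow> 1/2 \<le> \<alpha> i \<and> \<alpha> i \<le> 5/8"
proof -
  assume "i \<le> n + 2"
  then have "real i * h \<le> (real n + 2) * h"
    using h by (intro mult_right_mono) auto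
  also have "\<dots> \<le> (real n ^ 2) * h"
  proof (intro mult_right_mono)
    have "2 * real n \<le> real n ^ 2"
      unfolding power2_eq_square using n by (intro mult_right_mono) auto
    then show "real n + 2 \<le> real n ^ 2" using n by linarith
  qed (use h in auto)
  also have "\<dots> = 1/8" using h(3) by simp
  finally show ?thesis using h by (simp add: \<alpha>_def)
qed

text \<open>The increasing weights gain \<open>2 * h\<close> to first order, and \<open>h\<close> is
  chosen so that the second order loss is at most \<open>8 * n^2 * h^2 = h\<close>.\<close>

lemma weights_sum_squares:
  assumes "i \<in> {1..n}"
  shows "(\<alpha> i)\<^sup>2 + (1 - \<alpha> (i + 1))\<^sup>2 + ((\<alpha> (i - 1))\<^sup>2 + (1 - \<alpha> i)\<^sup>2) \<le> 1 - h"
proof -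
  have "(\<alpha> i)\<^sup>2 + (1 - \<alpha> (i + 1))\<^sup>2 + ((\<alpha> (i - 1))\<^sup>2 + (1 - \<alpha> i)\<^sup>2)
      = 1 - 2 * h + (4 * (real i)\<^sup>2 + 2) * h\<^sup>2"
    using assms by (simp add: \<alpha>_def of_nat_diff) (simp add: power2_eq_square algebra_simps)
  also have "(4 * (real i)\<^sup>2 + 2) * h\<^sup>2 \<le> (8 * (real n)\<^sup>2) * h\<^sup>2"
  proof (intro mult_right_mono)
    have "(real i)\<^sup>2 \<le> (real n)\<^sup>2" "1 \<le> (real n)\<^sup>2"
      using assms n by auto
    then show "4 * (real i)\<^sup>2 + 2 \<le> 8 * (real n)\<^sup>2" by linarith
  qed simp
  also have "\<dots> = h"
    using h(3) by (simp add: power2_eq_square)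
  finally show ?thesis by simp
qed

text \<open>If \<open>b\<^sub>i = - (x\<^sub>i v\<^sup>* + y\<^sub>i u\<^sup>*)\<close> then \<open>- b\<^sub>i v = x\<^sub>i\<close> and \<open>- b\<^sub>i u = y\<^sub>i\<close>; the choice below makes
  \<open>x\<^sub>i + y\<^sub>i\<^sub>-\<^sub>1 = z\<^sub>i\<close>.\<close>

definition column_of :: "(nat \<Rightarrow> 'a) \<Rightarrow> nat \<Rightarrow> 'a"
  where "column_of z i = - ((\<alpha> i *\<^sub>R z i) * star v + ((1 - \<alpha> (i + 1)) *\<^sub>R z (i + 1)) * star u)"

lemma column_of_diff: "column_of (\<lambda>i. z i - w i) i = column_of z i - column_of w i"
  unfolding column_of_def scaleR_right_diff_distrib left_diff_distrib by simp

lemma norm_column_of_square: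
  assumes "\<And>j. norm (z j) \<le> d"
  shows "(norm (column_of z i))\<^sup>2 \<le> ((\<alpha> i)\<^sup>2 + (1 - \<alpha> (i + 1))\<^sup>2) * d\<^sup>2"
proof -
  have "(norm (z j))\<^sup>2 \<le> d\<^sup>2" for j
    using assms[of j] by (intro power_mono) auto
  then have *: "(norm (a *\<^sub>R z j))\<^sup>2 \<le> a\<^sup>2 * d\<^sup>2" for a j
    by (simp add: power_mult_distrib mult_left_mono)
  show ?thesis
    unfolding column_of_def norm_minus_cancel distrib_right
    by (rule order_trans[OF norm_column add_mono[OF * *]])
qed

lemma norm_column_of:
  assumes z: "\<And>j. norm (z j) \<le> d" and i: "i \<le> n + 1"
  shows "norm (column_of z i) \<le> d"
proof (rule power2_le_imp_le)
  show d: "0 \<le> d" using z norm_ge_zero order_trans by blast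
  have "(\<alpha> i)\<^sup>2 \<le> (5/8)\<^sup>2" "(1 - \<alpha> (i + 1))\<^sup>2 \<le> (1/2)\<^sup>2"
    using weights_bounds[of i] weights_bounds[of "i + 1"] i
    by (intro power_mono; simp)+
  then have "(\<alpha> i)\<^sup>2 + (1 - \<alpha> (i + 1))\<^sup>2 \<le> 1"
    by (simp add: power2_eq_square)
  then show "(norm (column_of z i))\<^sup>2 \<le> d\<^sup>2"
    using norm_column_of_square[of z d i] z mult_right_mono[of _ 1 "d\<^sup>2"] by fastforce
qed

text \<open>\<open>norm_row\<close> and \<open>norm_column\<close> in succession leave exactly the
  four squared weights summed above; the square root turns \<open>1 - h\<close> into at most
  \<open>1 - h / 2\<close>.\<close>

lemma norm_linear_part:
  assumes z: "\<And>j. norm (z j) \<le> d" and i: "i \<in> {1..n}"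
  shows "norm (v * column_of z i + u * column_of z (i - 1)) \<le> (1 - h / 2) * d"
proof (rule power2_le_imp_le)
  have d: "0 \<le> d" using z norm_ge_zero order_trans by blast
  then show "0 \<le> (1 - h / 2) * d" using h by simp
  have "(norm (v * column_of z i + u * column_of z (i - 1)))\<^sup>2
      \<le> ((\<alpha> i)\<^sup>2 + (1 - \<alpha> (i + 1))\<^sup>2) * d\<^sup>2 + ((\<alpha> (i - 1))\<^sup>2 + (1 - \<alpha> (i - 1 + 1))\<^sup>2) * d\<^sup>2"
    by (intro order_trans[OF norm_row] add_mono norm_column_of_square z)
  also have "\<dots> = ((\<alpha> i)\<^sup>2 + (1 - \<alpha> (i + 1))\<^sup>2 + ((\<alpha> (i - 1))\<^sup>2 + (1 - \<alpha> i)\<^sup>2)) * d\<^sup>2"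
    using i by (simp add: distrib_right)
  also have "\<dots> \<le> (1 - h) * d\<^sup>2"
    using weights_sum_squares[OF i] by (intro mult_right_mono) auto
  also have "\<dots> \<le> (1 - h / 2)\<^sup>2 * d\<^sup>2"
    by (intro mult_right_mono) (auto simp: power2_eq_square algebra_simps)
  finally show "(norm (v * column_of z i + u * column_of z (i - 1)))\<^sup>2 \<le> ((1 - h / 2) * d)\<^sup>2"
    by (simp add: power_mult_distrib)
qed

text \<open>For \<open>i\<close> in \<open>{2..n}\<close> the defect of \<open>column_of z\<close>
  is \<open>\<mu>\<close> times \<open>z i - fixed_point_map z i\<close>. The equation at
  \<open>1\<close> is given up: \<open>z 1 = 0\<close> is what makes \<open>column_of z 0\<close>
  vanish, as zeros beyond \<open>n\<close> do for \<open>column_of z (n + 1)\<close>.\<close>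

definition fixed_point_map :: "(nat \<Rightarrow> 'a) \<Rightarrow> nat \<Rightarrow> 'a"
  where "fixed_point_map z i = (if i \<in> {2..n} then
      (if i = n then (real n / \<mu>) *\<^sub>R 1 else 0) - (v * column_of z i + u * column_of z (i - 1))
      - column_of z i * commutator u (column_of z n) - (real i / \<mu>) *\<^sub>R column_of z (i + 1)
    else 0)"

lemma commutators_column_of:
  assumes "i \<ge> 1"
  shows "commutator v (column_of z i) + commutator u (column_of z (i - 1))
    = z i + (v * column_of z i + u * column_of z (i - 1))"
proof -
  have "column_of z i * v = - (\<alpha> i *\<^sub>R z i)"
    by (simp add: column_of_def distrib_right left_diff_distrib mult.assoc vv uv)
  moreover have "column_of z (i - 1) * u = - ((1 - \<alpha> i) *\<^sub>R z i)"
    using assms by (simp add: column_of_def distrib_right left_diff_distrib mult.assoc uu vu)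
  ultimately show ?thesis
    by (simp add: commutator_def algebra_simps)
qed

section \<open>Invariance and contraction on a small ball\<close>

definition solution_ball :: "(nat \<Rightarrow> 'a) set"
  where "solution_ball = {z. (\<forall>i. norm (z i) \<le> h / 16) \<and> (\<forall>i. i \<notin> {2..n} \<longrightarrow> z i = 0)}"

lemma norm_generators: "norm u \<le> 1" "norm v \<le> 1" "norm (1::'a) \<le> 1"
  using norm_isometry[OF uu] norm_isometry[OF vv] norm_isometry[of "1::'a"] by simp_all

lemma norm_shift_term:
  assumes z: "\<And>j. norm (z j) \<le> d" and i: "i \<le> n"
  shows "norm ((real i / \<mu>) *\<^sub>R column_of z (i + 1)) \<le> h / 8 * d"
proof -
  have d: "0 \<le> d" using z norm_ge_zero order_trans by blast
  have "real i / \<mu> \<le> real n / \<mu>"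
    using i \<mu>(1) by (intro divide_right_mono) auto
  also have "\<dots> \<le> h / 8"
    using h mult_left_mono[of h 1 h] unfolding \<mu>(2) power2_eq_square by linarith
  finally have "real i / \<mu> \<le> h / 8" .
  moreover have "norm (column_of z (i + 1)) \<le> d"
    using norm_column_of[of z, OF z] i by simp
  ultimately have "(real i / \<mu>) * norm (column_of z (i + 1)) \<le> (h / 8) * d"
    using h by (intro mult_mono) auto
  then show ?thesis
    using \<mu>(1) by simp
qed

text \<open>The linear part leaves a margin of \<open>(h / 2) * (h / 16)\<close>, four times
  \<open>h\<^sup>2 / 128\<close>. The inhomogeneous, quadratic and shift terms take at most one such
  share each.\<close>

lemma fixed_point_map_solution_ball:
  assumes z: "z \<in> solution_ball"
  shows "fixed_point_map z \<in> solution_ball"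
proof -
  have zr: "norm (z j) \<le> h / 16" for j using z by (simp add: solution_ball_def)
  have "norm (fixed_point_map z i) \<le> h / 16" if i: "i \<in> {2..n}" for i
  proof -
    have "norm ((if i = n then (real n / \<mu>) *\<^sub>R 1 else 0) :: 'a) \<le> h\<^sup>2 / 128"
      using mult_left_mono[OF norm_generators(3), of "h\<^sup>2 / 128"] by (simp add: \<mu>(2))
    moreover have "norm (v * column_of z i + u * column_of z (i - 1)) \<le> (1 - h / 2) * (h / 16)"
      using norm_linear_part[of z, OF zr] i by simp
    moreover have "norm (column_of z i * commutator u (column_of z n)) \<le> h / 16 * (2 * (h / 16))"
      using i h by (intro order_trans[OF norm_mult_ineq] mult_mono norm_commutator
          norm_generators norm_column_of zr) auto
    moreover have "norm ((real i / \<mu>) *\<^sub>R column_of z (i + 1)) \<le> h / 8 * (h / 16)"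
      using norm_shift_term[of z, OF zr] i by simp
    ultimately have "norm (fixed_point_map z i)
        \<le> h\<^sup>2 / 128 + (1 - h / 2) * (h / 16) + h / 16 * (2 * (h / 16)) + h / 8 * (h / 16)"
      unfolding fixed_point_map_def using i
      by (simp only: if_True) (intro order_trans[OF norm_triangle_ineq4] add_mono)
    also have "\<dots> = h / 16 - h\<^sup>2 / 128"
      by (simp add: power2_eq_square field_simps)
    also have "\<dots> \<le> h / 16"
      by simp
    finally show ?thesis .
  qed
  moreover have outside: "fixed_point_map z i = 0" if "i \<notin> {2..n}" for i
    using that by (auto simp: fixed_point_map_def)
  moreover have "norm (fixed_point_map z i) \<le> h / 16" if "i \<notin> {2..n}" for i
    using h(1) by (simp only: outside[OF that]) simp
  ultimately show ?thesis
    unfolding solution_ball_def by blast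
qed

text \<open>The quadratic term changes by \<open>(b - b') c + b' (c - c')\<close>. These two pieces
  and the shift term cost \<open>h / 8\<close> each, out of the gain \<open>h / 2\<close>.\<close>

lemma fixed_point_map_lipschitz:
  assumes z: "z \<in> solution_ball" and w: "w \<in> solution_ball" and d: "\<And>j. norm (z j - w j) \<le> d"
  shows "norm (fixed_point_map z i - fixed_point_map w i) \<le> (1 - h / 8) * d"
proof (cases "i \<in> {2..n}")
  case True
  have d0: "0 \<le> d" using d norm_ge_zero order_trans by blast
  have zr: "norm (z j) \<le> h / 16" and wr: "norm (w j) \<le> h / 16" for j
    using z w by (simp_all add: solution_ball_def)
  let ?y = "\<lambda>j. z j - w j"
  let ?l = "v * column_of ?y i + u * column_of ?y (i - 1)"
  let ?q1 = "column_of ?y i * commutator u (column_of z n)"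
  let ?q2 = "column_of w i * commutator u (column_of ?y n)"
  let ?s = "(real i / \<mu>) *\<^sub>R column_of ?y (i + 1)"
  have eq: "fixed_point_map z i - fixed_point_map w i = - ?l - ?q1 - ?q2 - ?s"
  proof -
    have *: "e - (v * b1 + u * b2) - b1 * c - r *\<^sub>R b3 - (e - (v * b1' + u * b2') - b1' * c' - r *\<^sub>R b3')
        = - (v * (b1 - b1') + u * (b2 - b2')) - (b1 - b1') * c - b1' * (c - c') - r *\<^sub>R (b3 - b3')"
      for e b1 b2 b3 b1' b2' b3' c c' :: 'a and r :: real
      by (simp add: algebra_simps)
    have **: "commutator u (b - b') = commutator u b - commutator u b'" for b b' :: 'a
      by (simp add: commutator_def algebra_simps)
    show ?thesis
      unfolding fixed_point_map_def if_P[OF True] column_of_diff ** by (rule *)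
  qed
  have "norm (fixed_point_map z i - fixed_point_map w i) \<le> norm ?l + norm ?q1 + norm ?q2 + norm ?s"
    unfolding eq using norm_triangle_ineq4[of "- ?l - ?q1 - ?q2" ?s] norm_triangle_ineq4[of "- ?l - ?q1" ?q2]
      norm_triangle_ineq4[of "- ?l" ?q1] unfolding norm_minus_cancel by linarith
  moreover have "norm ?l \<le> (1 - h / 2) * d"
    using True by (intro norm_linear_part d) auto
  moreover have "norm ?q1 \<le> d * (2 * (h / 16))"
    using True d0 by (intro order_trans[OF norm_mult_ineq] mult_mono norm_column_of d
        norm_commutator norm_generators zr norm_ge_zero) auto
  moreover have "norm ?q2 \<le> h / 16 * (2 * d)"
    using True h(1) by (intro order_trans[OF norm_mult_ineq] mult_mono norm_column_of d
        norm_commutator norm_generators wr norm_ge_zero) auto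
  moreover have "norm ?s \<le> h / 8 * d"
    using True by (intro norm_shift_term d) auto
  moreover have "(1 - h / 2) * d + d * (2 * (h / 16)) + h / 16 * (2 * d) + h / 8 * d = (1 - h / 8) * d"
    by (simp add: field_simps)
  ultimately show ?thesis
    by linarith
next
  case False
  have "0 \<le> d" using d norm_ge_zero order_trans by blast
  with False h show ?thesis by (auto simp: fixed_point_map_def)
qed

section \<open>Norms of the conjugated matrices\<close>

abbreviation \<sigma> :: "nat \<Rightarrow> 'a"
  where "\<sigma> \<equiv> isometries n"

sublocale dual: dual_system n "\<lambda>i. 2 ^ i *\<^sub>R \<sigma> i" "\<lambda>i. (1/2) ^ i *\<^sub>R star (\<sigma> i)"
  using n by (intro dual_system_isometries) auto

lemma norm_conjugated_unit:
  assumes "i \<in> {1..n}" "j \<in> {1..n}" "norm a \<le> d"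
  shows "norm (2 ^ i *\<^sub>R \<sigma> i * a * (1/2) ^ j *\<^sub>R star (\<sigma> j)) \<le> 2 ^ i * (1/2) ^ j * d"
proof -
  have d: "0 \<le> d" using assms(3) norm_ge_zero order_trans by blast
  have "norm (\<sigma> i * a * star (\<sigma> j)) \<le> 1 * d * 1"
    using assms d norm_isometries[of _ n]
    by (intro order_trans[OF norm_mult_ineq] mult_mono) auto
  then show ?thesis
    by (simp add: mult_left_mono)
qed

text \<open>Entry \<open>i\<close> carries the factor \<open>2^(i-n)\<close>: the corner is damped
  most, and the other rows form a geometric sum below \<open>2\<close>.\<close>

lemma norm_last_column:
  assumes c: "\<And>i. i \<in> {2..n} \<Longrightarrow> norm (c i) \<le> d" and c1: "norm (c 1) \<le> e"
  shows "norm (dual.last_column c) \<le> (1/2) ^ (n - 1) * e + 2 * d"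
proof -
  obtain m where m: "n = Suc m" "1 \<le> m" using n by (cases n) auto
  have d: "0 \<le> d" using c[of n] n norm_ge_zero[of "c n"] by (simp del: norm_ge_zero)
  have "norm (dual.last_column c) \<le> (\<Sum>i=1..n. norm (2 ^ i *\<^sub>R \<sigma> i * c i * (1/2) ^ n *\<^sub>R star (\<sigma> n)))"
    unfolding dual.last_column_def by (rule norm_sum)
  also have "\<dots> \<le> (\<Sum>i=1..n. 2 ^ i * (1/2) ^ n * (if i = 1 then e else d))"
    using n c c1 by (intro sum_mono norm_conjugated_unit) auto
  also have "\<dots> = 2 * (1/2) ^ n * e + (\<Sum>i=2..n. 2 ^ i * (1/2) ^ n * d)"
    unfolding m by (subst sum.atLeast_Suc_atMost[of 1 "Suc m"])
      (auto intro!: arg_cong2[of _ _ _ _ "(+)"] sum.cong simp: numeral_2_eq_2)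
  also have "(\<Sum>i=2..n. 2 ^ i * (1/2) ^ n * d) = (\<Sum>i=2..n. 2 ^ i) * ((1/2) ^ n * d)"
    by (simp add: sum_distrib_right mult.assoc)
  also have "\<dots> \<le> 2 ^ Suc n * ((1/2) ^ n * d)"
  proof (rule mult_right_mono)
    have "(\<Sum>i=2..n. 2 ^ i :: real) \<le> (\<Sum>i<Suc n. 2 ^ i)"
      by (rule sum_mono2) auto
    also have "\<dots> \<le> 2 ^ Suc n"
      by (simp only: sum_gp_strict) simp
    finally show "(\<Sum>i=2..n. 2 ^ i :: real) \<le> 2 ^ Suc n" .
  qed (use d in simp)
  also have "\<dots> = 2 * d"
    by (simp add: power_one_over)
  also have "2 * (1/2) ^ n * e = (1/2) ^ (n - 1) * e"
    unfolding m by simp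
  finally show ?thesis by simp
qed

text \<open>The scalings cancel on the diagonal, so ampliation is a unital star-homomorphism and
  preserves isometries.\<close>

lemma norm_ampliation:
  assumes "star a * a = 1"
  shows "norm (dual.ampliation a) \<le> 1"
proof (rule norm_isometry)
  have "dual.ampliation a = (\<Sum>i=1..n. \<sigma> i * a * star (\<sigma> i))" for a
    unfolding dual.ampliation_def mult_scaleR_left mult_scaleR_right scaleR_scaleR half_two_power
      scaleR_one ..
  then have star: "star (dual.ampliation a) = dual.ampliation (star a)"
    by (simp add: star_sum star_mult star_star mult.assoc)
  have amp: "dual.ampliation b * \<sigma> j = \<sigma> j * b" if "j \<in> {1..n}" for b j
    using dual.ampliation_t[OF that, of b] by simp
  show "star (dual.ampliation a) * dual.ampliation a = 1"
    unfolding star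
  proof (rule dual.eqI)
    fix j assume j: "j \<in> {1..n}"
    have "dual.ampliation (star a) * (dual.ampliation a * \<sigma> j) = \<sigma> j * (star a * a)"
      unfolding amp[OF j, of a] by (simp only: amp[OF j] flip: mult.assoc)
    then show "dual.ampliation (star a) * dual.ampliation a * 2 ^ j *\<^sub>R \<sigma> j = 1 * 2 ^ j *\<^sub>R \<sigma> j"
      by (simp only: assms mult.assoc mult_scaleR_right mult_1_left mult_1_right)
  qed
qed

text \<open>Conjugation multiplies every subdiagonal entry by \<open>2\<close>; what remains is the
  partial isometry \<open>S\<close>.\<close>

lemma norm_lower_shift: "norm dual.lower_shift \<le> 2"
proof -
  define S where "S = (\<Sum>i=1..<n. \<sigma> (Suc i) * star (\<sigma> i))"
  have shift: "dual.lower_shift = 2 *\<^sub>R S"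
    unfolding dual.lower_shift_def S_def scaleR_sum_right
    by (intro sum.cong refl) (simp add: power_one_over)
  have S\<sigma>: "S * \<sigma> j = (if j < n then \<sigma> (Suc j) else 0)" if "j \<in> {1..n}" for j
  proof -
    have "S * \<sigma> j = (\<Sum>i=1..<n. if i = j then \<sigma> (Suc j) else 0)"
      unfolding S_def sum_distrib_right
      using that by (intro sum.cong) (auto simp: mult.assoc star_isometries_mult)
    then show ?thesis using that by simp
  qed
  have star_S\<sigma>: "star S * \<sigma> (Suc j) = \<sigma> j" if "j \<in> {1..<n}" for j
  proof -
    have "star S * \<sigma> (Suc j) = (\<Sum>i=1..<n. if i = j then \<sigma> j else 0)"
      unfolding S_def star_sum sum_distrib_right
      using that by (intro sum.cong) (auto simp: star_mult star_star mult.assoc star_isometries_mult)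
    then show ?thesis using that by simp
  qed
  have "S * (star S * S) = S"
  proof (rule dual.eqI)
    fix j assume j: "j \<in> {1..n}"
    have "S * (star S * (S * \<sigma> j)) = S * \<sigma> j"
      using j by (cases "j < n") (simp_all add: S\<sigma> star_S\<sigma>)
    then show "S * (star S * S) * 2 ^ j *\<^sub>R \<sigma> j = S * 2 ^ j *\<^sub>R \<sigma> j"
      by (simp only: mult_scaleR_right mult.assoc)
  qed
  then show ?thesis
    using norm_partial_isometry[of S] by (simp add: shift)
qed

text \<open>The triangle inequality is enough here, since \<open>n^2\<close> is dominated by
  \<open>\<mu>\<close>.\<close>

lemma norm_weighted_upper_shift: "norm dual.weighted_upper_shift \<le> real n ^ 2"
proof -
  have "norm dual.weighted_upper_shift
      \<le> (\<Sum>i=1..<n. norm (real i *\<^sub>R (2 ^ i *\<^sub>R \<sigma> i * (1/2) ^ Suc i *\<^sub>R star (\<sigma> (Suc i)))))"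
    unfolding dual.weighted_upper_shift_def by (rule norm_sum)
  also have "\<dots> \<le> (\<Sum>i=1..<n. real n)"
  proof (rule sum_mono)
    fix i assume i: "i \<in> {1..<n}"
    have "norm (2 ^ i *\<^sub>R \<sigma> i * 1 * (1/2) ^ Suc i *\<^sub>R star (\<sigma> (Suc i))) \<le> 2 ^ i * (1/2) ^ Suc i * 1"
      using i by (intro norm_conjugated_unit norm_generators) auto
    also have "2 ^ i * (1/2) ^ Suc i * 1 \<le> (1 :: real)"
      by (simp add: power_one_over)
    finally have "real i * norm (2 ^ i *\<^sub>R \<sigma> i * (1/2) ^ Suc i *\<^sub>R star (\<sigma> (Suc i))) \<le> real n * 1"
      using i by (intro mult_mono) auto
    then show "norm (real i *\<^sub>R (2 ^ i *\<^sub>R \<sigma> i * (1/2) ^ Suc i *\<^sub>R star (\<sigma> (Suc i)))) \<le> real n"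
      by (simp only: norm_scaleR abs_of_nat mult_1_right)
  qed
  also have "\<dots> \<le> real n ^ 2"
    by (simp add: power2_eq_square mult_right_mono)
  finally show ?thesis .
qed

lemma approximate_commutator:
  assumes "0 < \<epsilon>"
  obtains d x :: 'a where "norm (commutator d x - 1) \<le> (1/2) ^ (n - 1) * (5 * \<mu>) + \<epsilon>"
    and "norm d * norm x \<le> 15 * \<mu>"
proof -
  have "(\<lambda>_. 0) \<in> solution_ball"
    using h by (simp add: solution_ball_def)
  \<comment> \<open>The tolerance becomes \<open>\<epsilon> / 2\<close> after multiplication by
    \<open>\<mu>\<close>, and \<open>norm_last_column\<close> doubles it.\<close>
  then obtain z where z: "z \<in> solution_ball"
    and fp: "\<And>i. norm (fixed_point_map z i - z i) \<le> \<epsilon> / (2 * \<mu>)"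
    by (rule approximate_fixed_point[where F = fixed_point_map and r = "h / 16"
          and q = "1 - h / 8" and \<delta> = "\<epsilon> / (2 * \<mu>)"])
      (use h \<mu>(1) assms fixed_point_map_solution_ball fixed_point_map_lipschitz in
        \<open>auto simp: solution_ball_def\<close>)
  have zr: "norm (z j) \<le> h / 16" and z0: "j \<notin> {2..n} \<Longrightarrow> z j = 0" for j
    using z by (simp_all add: solution_ball_def)
  define b where "b = column_of z"
  have b0: "b 0 = 0" "b (Suc n) = 0"
    by (simp_all add: b_def column_of_def z0)
  \<comment> \<open>The radius \<open>h / 16\<close> is at most \<open>1/512\<close> because
    \<open>h\<close> is at most \<open>1/32\<close>.\<close>
  have b: "norm (b i) \<le> 1/512" if "i \<le> n + 1" for i
    using norm_column_of[of z, OF zr that] h by (simp add: b_def)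
  let ?d = "dual.conjugate_variable \<mu> u v b" and ?x = "dual.companion b"
  have "norm (commutator ?d ?x - 1) \<le> (1/2) ^ (n - 1) * (5 * \<mu>) + 2 * (\<epsilon> / 2)"
    unfolding dual.commutator_companion[of b, OF b0]
  proof (rule norm_last_column)
    fix i assume i: "i \<in> {2..n}"
    have "dual.last_column_defect \<mu> u v b i = \<mu> *\<^sub>R (z i - fixed_point_map z i)"
      using i \<mu>(1) commutators_column_of[of i z]
      by (simp add: dual.last_column_defect_def fixed_point_map_def b_def scaleR_right_distrib
          scaleR_right_diff_distrib)
    also have "norm \<dots> \<le> \<mu> * (\<epsilon> / (2 * \<mu>))"
      using fp[of i] \<mu>(1) by (simp add: norm_minus_commute del: times_divide_eq_right)
    finally show "norm (dual.last_column_defect \<mu> u v b i) \<le> \<epsilon> / 2"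
      using \<mu>(1) by simp
  next
    \<comment> \<open>Row \<open>1\<close> was left unsolved. A bound of order \<open>\<mu>\<close>
      suffices, since this entry is damped by \<open>(1/2) ^ (n - 1)\<close>.\<close>
    have *: "norm (commutator u (b n)) \<le> 2 * (1/512)" "norm (commutator v (b 1)) \<le> 2 * (1/512)"
      using n by (intro norm_commutator norm_generators b; simp)+
    have "norm (b 1 * commutator u (b n)) \<le> (1/512) * (2 * (1/512))"
      using n * by (intro order_trans[OF norm_mult_ineq] mult_mono b) auto
    then have "norm (commutator v (b 1) + b 1 * commutator u (b n)) \<le> 4"
      using * norm_triangle_ineq[of "commutator v (b 1)" "b 1 * commutator u (b n)"] by simp
    then have "norm (\<mu> *\<^sub>R (commutator v (b 1) + b 1 * commutator u (b n))) \<le> \<mu> * 4"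
      using \<mu>(1) by simp
    moreover have "norm (b 2) \<le> \<mu>"
      using b[of 2] n \<mu>(1) by simp
    moreover have "dual.last_column_defect \<mu> u v b 1
        = \<mu> *\<^sub>R (commutator v (b 1) + b 1 * commutator u (b n)) + b 2"
      using n b0 by (simp add: dual.last_column_defect_def commutator_def numeral_2_eq_2)
    ultimately show "norm (dual.last_column_defect \<mu> u v b 1) \<le> 5 * \<mu>"
      using norm_triangle_ineq[of "\<mu> *\<^sub>R (commutator v (b 1) + b 1 * commutator u (b n))" "b 2"] by simp
  qed
  moreover have "norm ?d * norm ?x \<le> (5 * \<mu>) * 3"
  proof (rule mult_mono)
    have "norm (dual.last_column b) \<le> (1/2) ^ (n - 1) * (1/512) + 2 * (1/512)"
      using n by (intro norm_last_column b) auto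
    also have "\<dots> \<le> 1 * (1/512) + 2 * (1/512)"
      by (intro add_mono mult_right_mono power_le_one) auto
    finally show x: "norm ?x \<le> 3"
      using norm_triangle_ineq[of dual.lower_shift "dual.last_column b"] norm_lower_shift
      by (simp add: dual.companion_def)
    have "norm (?x * dual.ampliation u) \<le> 3 * 1"
      using x by (intro order_trans[OF norm_mult_ineq] mult_mono norm_ampliation uu) auto
    then have "norm (dual.ampliation v + ?x * dual.ampliation u) \<le> 4"
      using norm_triangle_ineq[of "dual.ampliation v" "?x * dual.ampliation u"] norm_ampliation[OF vv]
      by simp
    then have "norm (\<mu> *\<^sub>R (dual.ampliation v + ?x * dual.ampliation u)) \<le> \<mu> * 4"
      using \<mu>(1) by simp
    moreover have "real n ^ 2 \<le> \<mu>"
    proof -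
      have "1 * real n ^ 2 \<le> 8192 * real n ^ 5"
        using n by (intro mult_mono power_increasing) auto
      then show ?thesis
        by (simp only: \<mu>_def mult_1)
    qed
    ultimately show "norm ?d \<le> 5 * \<mu>"
      using norm_triangle_ineq[of "\<mu> *\<^sub>R (dual.ampliation v + ?x * dual.ampliation u)" dual.weighted_upper_shift]
        norm_weighted_upper_shift by (simp add: dual.conjugate_variable_def)
  qed (use \<mu>(1) in auto)
  ultimately show ?thesis
    using that[of ?d ?x] by simp
qed

end

section \<open>Choice of the matrix size\<close>

theorem theorem2p12:
  fixes u v :: "'a::unital_cstar_algebra"
  assumes "star u * u = 1"
    and "star v * v = 1"
    and "u * star u + v * star v = 1"
    and "star u * v = 0"
    and "star v * u = 0"
  shows "\<exists>\<gamma>::real. \<gamma> > 0 \<and>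
    (\<forall>\<epsilon>::real. 0 < \<epsilon> \<and> \<epsilon> \<le> 1/2 \<longrightarrow>
      (\<exists>d x :: 'a. norm (commutator d x - 1) \<le> \<epsilon> \<and>
        norm d * norm x \<le> \<gamma> * (ln (1 / \<epsilon>)) ^ 5))"
proof -
  interpret cuntz_pair u v
    using assms by unfold_locales
  \<comment> \<open>The damping \<open>(1/2) ^ (n - 1)\<close> is split as
    \<open>2 * (3/4) ^ n * (2/3) ^ n\<close>: the first power absorbs \<open>n^5\<close>, the second
    produces \<open>\<epsilon>\<close>.\<close>
  have "((\<lambda>n. 2 * (3/4) ^ n * (5 * (8192 * real n ^ 5))) \<longlongrightarrow> 0) sequentially"
    by real_asymp
  then have "\<forall>\<^sub>F n in sequentially. 2 * (3/4) ^ n * (5 * (8192 * real n ^ 5)) < 1/2"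
    by (rule order_tendstoD) simp
  then obtain n0 where n0: "\<And>n. n \<ge> n0 \<Longrightarrow> 2 * (3/4) ^ n * (5 * (8192 * real n ^ 5)) < 1/2"
    by (auto simp: eventually_sequentially)
  have exp_bound: "(2/3) ^ n \<le> exp (- (real n / 3))" for n
    using power_mono[OF exp_ge_add_one_self[of "- (1/3)"], of n]
    unfolding exp_of_nat_mult[symmetric] by simp
  \<comment> \<open>Since \<open>L\<close> below is at least \<open>ln 2\<close>, the constant
    \<open>n0 + 3\<close> is at most \<open>(n0 + 3) / ln 2 * L\<close>, which gives
    \<open>n \<le> K * L\<close> with \<open>K\<close> independent of
    \<open>\<epsilon>\<close>.\<close>
  define K where "K = (real n0 + 3) / ln 2 + 3"
  have K: "0 < K" unfolding K_def by (intro add_nonneg_pos divide_nonneg_pos) auto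
  show ?thesis
  proof (intro exI[of _ "15 * 8192 * K ^ 5"] conjI allI impI)
    fix \<epsilon> :: real assume "0 < \<epsilon> \<and> \<epsilon> \<le> 1/2"
    then have \<epsilon>: "0 < \<epsilon>" "\<epsilon> \<le> 1/2" by auto
    define L where "L = ln (1 / \<epsilon>)"
    have "2 \<le> 1 / \<epsilon>" using \<epsilon> by (simp add: field_simps)
    then have L: "ln 2 \<le> L" using \<epsilon> by (simp add: L_def)
    have L0: "0 < L" using L ln_gt_zero[of "2::real"] by linarith
    \<comment> \<open>\<open>n0\<close> lets the polynomial be absorbed, \<open>2\<close> meets the
      size condition of the locale, and \<open>3 * L\<close> makes \<open>exp (- n / 3)\<close> at
      most \<open>\<epsilon>\<close>.\<close>
    define n where "n = n0 + 2 + nat \<lceil>3 * L\<rceil>"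
    have nL: "3 * L \<le> real n" "real n \<le> real n0 + 3 + 3 * L"
      using L0 by (simp_all add: n_def) linarith+
    interpret companion_equations u v n
      by unfold_locales (simp_all add: n_def)
    obtain d x :: 'a where
      dx: "norm (commutator d x - 1) \<le> (1/2) ^ (n - 1) * (5 * (8192 * real n ^ 5)) + \<epsilon> / 2"
        "norm d * norm x \<le> 15 * (8192 * real n ^ 5)"
      using approximate_commutator[of "\<epsilon> / 2"] \<epsilon> unfolding \<mu>_def by auto
    have "(1/2) ^ (n - 1) = 2 * ((3/4) ^ n * (2/3) ^ n :: real)"
      unfolding power_mult_distrib[symmetric] using power_Suc[of "1/2 :: real" "n - 1"]
      by (simp add: n_def)
    then have "(1/2) ^ (n - 1) * (5 * (8192 * real n ^ 5))
        = 2 * (3/4) ^ n * (5 * (8192 * real n ^ 5)) * (2/3) ^ n"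
      by (simp only: mult_ac)
    also have "\<dots> \<le> (1/2) * exp (- (real n / 3))"
      using n0[of n] exp_bound[of n] by (intro mult_mono) (auto simp: n_def)
    also have "\<dots> \<le> (1/2) * exp (- L)"
      using nL by simp
    also have "exp (- L) = \<epsilon>"
      using \<epsilon> by (simp add: L_def ln_div)
    finally have "norm (commutator d x - 1) \<le> \<epsilon>"
      using dx(1) by simp
    moreover have "norm d * norm x \<le> 15 * 8192 * K ^ 5 * L ^ 5"
    proof -
      have "real n0 + 3 \<le> (real n0 + 3) / ln 2 * L"
        using mult_left_mono[OF L, of "(real n0 + 3) / ln 2"] by simp
      then have "real n \<le> K * L"
        using nL by (simp add: K_def distrib_right)
      then have "real n ^ 5 \<le> (K * L) ^ 5"
        by (rule power_mono) simp
      then show ?thesis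
        using dx(2) by (simp add: power_mult_distrib)
    qed
    ultimately show "\<exists>d x :: 'a. norm (commutator d x - 1) \<le> \<epsilon> \<and>
        norm d * norm x \<le> 15 * 8192 * K ^ 5 * ln (1 / \<epsilon>) ^ 5"
      unfolding L_def by blast
  qed (use K in simp)
qed

end
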